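(* Let $k\geq 1$. Let $\mathcal{C}$ be a hereditary class of $\mathcal{L}$-structures which is $k$-overlap closed, and let $\mathcal{C}'$ be a hereditary class of $\mathcal{L}'$-structures whose labelled growth rate satisfies $|\mathcal{C}'[n]| = O(e^{n^{k+\delta}})$ for every $\delta>0$. Then every consistent random $\mathcal{C}'$-expansion of $\mathcal{C}$ is exchangeable.
   Context: $\mathcal{L}$ and $\mathcal{L}'$ are disjoint relational languages, and every relation symbol is interpreted injectively (a relation never holds of a tuple with repeated entries). A hereditary class of $\mathcal{L}$-structures is a class of $\mathcal{L}$-structures whose domains are finite subsets of $\mathbb{N}$, closed under isomorphism and under substructures. For a hereditary class $\mathcal{D}$, $\mathcal{D}[n]$ denotes the set of members with domain $[n]=\{1,\dots,n\}$; the labelled growth rate of $\mathcal{D}$ is $n\mapsto|\mathcal{D}[n]|$. For an $\mathcal{L}$-structure $A$ and an $\mathcal{L}'$-structure $B$ on the same domain, $A*B$ is the $\mathcal{L}\cup\mathcal{L}'$-structure with $\mathcal{L}$-reduct $A$ and $\mathcal{L}'$-reduct $B$. A consistent random $\mathcal{C}'$-expansion of $\mathcal{C}$ is an assignment to each $A\in\mathcal{C}$ of a probability distribution $\mathbb{P}_A$ on the set of $\mathcal{L}'$-structures with the same domain as $A$, concentrated on members of $\mathcal{C}'$, such that for every embedding $\phi:\mathbf{H}\to\mathbf{G}$ between members of $\mathcal{C}$ and every $\mathcal{L}'$-structure $\mathbf{H}'$ on the domain of $\mathbf{H}$, $\mathbb{P}_{\mathbf{H}}(\mathbf{H}')$ equals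 the $\mathbb{P}_{\mathbf{G}}$-probability that the random $\mathcal{L}'$-structure on $G$, restricted to $\phi(H)$ and pulled back along $\phi$, equals $\mathbf{H}'$. We write $\mathbb{P}_A(A*A')$ for $\mathbb{P}_A(A')$. It is exchangeable if for all $r$, all $\mathbf{H}_1,\mathbf{H}_2\in\mathcal{C}[r]$ and every $\mathcal{L}'$-structure $\mathbf{H}'$ on $[r]$, $\mathbb{P}_{\mathbf{H}_1}(\mathbf{H}_1*\mathbf{H}')=\mathbb{P}_{\mathbf{H}_2}(\mathbf{H}_2*\mathbf{H}')$. $k$-overlap closed: a class $\mathcal{C}$ of relational structures, all of whose relation symbols have arity strictly greater than $k$, is $k$-overlap closed if for every $r>k$ there are constants $C(r)>0$ and $\alpha(r)>0$ such that for arbitrarily large $n$ there is an $r$-uniform hypergraph $\mathbb{K}$ on $n$ vertices with: (1) at least $C(r)n^{k+\alpha(r)}$ hyperedges; (2) no two hyperedges of $\mathbb{K}$ intersect in more than $k$ vertices; (3) for every $H_1,H_2\in\mathcal{C}[r]$ and every $\mathcal{L}$-structure $G_0$ on the vertex set of $\mathbb{K}$ whose induced substructure on each hyperedge of $\mathbb{K}$ is isomorphic to $H_1$ or to $H_2$, there is an injective homomorphism $g$ of $G_0$ into some $G\in\mathcal{C}$ with $n$ elements whose restriction to each hyperedge of $\mathbb{K}$ is an embedding. *)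

theory Defs
  imports "HOL-Probability.Probability_Mass_Function" "HOL-Library.Landau_Symbols"
begin

text \<open>
  A relational language is a set \<open>L\<close> of symbols (possibly empty or infinite); every symbol carries
  an arity \<open>ar s\<close>.  Structures interpret the symbols outside their language by the empty relation,
  so that two \<open>L\<close>-structures are equal as HOL values iff they are equal as \<open>L\<close>-structures, and maps
  between structures may be required to respect all symbols without mentioning \<open>L\<close>.
\<close>

datatype 's rel_struct =
  RelStruct (universe: "nat set") (interp: "'s \<Rightarrow> nat list set")

definition is_structure :: "('s \<Rightarrow> nat) \<Rightarrow> 's set \<Rightarrow> 's rel_struct \<Rightarrow> bool" where
  "is_structure ar L A \<longleftrightarrow>
     (\<forall>s\<in>L. \<forall>t\<in>interp A s. length t = ar s \<and> set t \<subseteq> universe A \<and> distinct t) \<and>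
     (\<forall>s. s \<notin> L \<longrightarrow> interp A s = {})"

definition induced :: "'s rel_struct \<Rightarrow> nat set \<Rightarrow> 's rel_struct" where
  "induced A X = RelStruct X (\<lambda>s. {t \<in> interp A s. set t \<subseteq> X})"

definition pullback :: "(nat \<Rightarrow> nat) \<Rightarrow> nat set \<Rightarrow> 's rel_struct \<Rightarrow> 's rel_struct" where
  "pullback f X B = RelStruct X (\<lambda>s. {t. set t \<subseteq> X \<and> map f t \<in> interp B s})"

definition homomorphism :: "(nat \<Rightarrow> nat) \<Rightarrow> 's rel_struct \<Rightarrow> 's rel_struct \<Rightarrow> bool" where
  "homomorphism f A B \<longleftrightarrow>
     f ` universe A \<subseteq> universe B \<and> (\<forall>s. \<forall>t\<in>interp A s. map f t \<in> interp B s)"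

definition embedding :: "(nat \<Rightarrow> nat) \<Rightarrow> 's rel_struct \<Rightarrow> 's rel_struct \<Rightarrow> bool" where
  "embedding f A B \<longleftrightarrow>
     f ` universe A \<subseteq> universe B \<and> inj_on f (universe A) \<and>
     (\<forall>s t. set t \<subseteq> universe A \<longrightarrow> (t \<in> interp A s \<longleftrightarrow> map f t \<in> interp B s))"

definition isomorphic :: "'s rel_struct \<Rightarrow> 's rel_struct \<Rightarrow> bool" where
  "isomorphic A B \<longleftrightarrow> (\<exists>f. embedding f A B \<and> f ` universe A = universe B)"

definition hereditary_class :: "('s \<Rightarrow> nat) \<Rightarrow> 's set \<Rightarrow> 's rel_struct set \<Rightarrow> bool" where
  "hereditary_class ar L \<C> \<longleftrightarrow>
     (\<forall>A\<in>\<C>. is_structure ar L A \<and> finite (universe A)) \<and>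
     (\<forall>A\<in>\<C>. \<forall>B. is_structure ar L B \<and> isomorphic A B \<longrightarrow> B \<in> \<C>) \<and>
     (\<forall>A\<in>\<C>. \<forall>X. X \<subseteq> universe A \<longrightarrow> induced A X \<in> \<C>)"

definition members_on :: "'s rel_struct set \<Rightarrow> nat \<Rightarrow> 's rel_struct set" where
  "members_on \<C> n = {A \<in> \<C>. universe A = {1..n}}"

definition labelled_growth_rate :: "'s rel_struct set \<Rightarrow> nat \<Rightarrow> nat" where
  "labelled_growth_rate \<C> n = card (members_on \<C> n)"

definition uniform_hypergraph :: "nat \<Rightarrow> nat set \<Rightarrow> nat set set \<Rightarrow> bool" where
  "uniform_hypergraph r V E \<longleftrightarrow> finite V \<and> (\<forall>e\<in>E. e \<subseteq> V \<and> card e = r)"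

definition overlap_closed ::
    "nat \<Rightarrow> ('s \<Rightarrow> nat) \<Rightarrow> 's set \<Rightarrow> 's rel_struct set \<Rightarrow> bool" where
  "overlap_closed k ar L \<C> \<longleftrightarrow>
     (\<forall>s\<in>L. k < ar s) \<and>
     (\<forall>r>k. \<exists>c>0. \<exists>\<alpha>>0. \<forall>N. \<exists>n\<ge>N. \<exists>V E.
        uniform_hypergraph r V E \<and> card V = n \<and>
        c * real n powr (real k + \<alpha>) \<le> real (card E) \<and>
        (\<forall>e\<in>E. \<forall>e'\<in>E. e \<noteq> e' \<longrightarrow> card (e \<inter> e') \<le> k) \<and>
        (\<forall>H1\<in>members_on \<C> r. \<forall>H2\<in>members_on \<C> r. \<forall>G0.
           is_structure ar L G0 \<and> universe G0 = V \<and>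
           (\<forall>e\<in>E. isomorphic (induced G0 e) H1 \<or> isomorphic (induced G0 e) H2) \<longrightarrow>
           (\<exists>G\<in>\<C>. \<exists>g. card (universe G) = n \<and>
              homomorphism g G0 G \<and> inj_on g V \<and>
              (\<forall>e\<in>E. embedding g (induced G0 e) G))))"

text \<open>
  A random expansion assigns to each \<open>A\<close> in \<open>\<C>\<close> a distribution \<open>P A\<close> on \<open>L'\<close>-structures with the
  same domain; the values of \<open>P\<close> outside \<open>\<C>\<close> are irrelevant.
\<close>

definition consistent_random_expansion ::
    "('s \<Rightarrow> nat) \<Rightarrow> 's set \<Rightarrow> 's rel_struct set \<Rightarrow> 's rel_struct set \<Rightarrow>
     ('s rel_struct \<Rightarrow> 's rel_struct pmf) \<Rightarrow> bool" where
  "consistent_random_expansion ar L' \<C> \<C>' P \<longleftrightarrow>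
     (\<forall>A\<in>\<C>. set_pmf (P A) \<subseteq> {A' \<in> \<C>'. universe A' = universe A}) \<and>
     (\<forall>H\<in>\<C>. \<forall>G\<in>\<C>. \<forall>\<phi>. embedding \<phi> H G \<longrightarrow>
        (\<forall>H'. is_structure ar L' H' \<and> universe H' = universe H \<longrightarrow>
           pmf (P H) H' = measure_pmf.prob (P G) {G'. pullback \<phi> (universe H) G' = H'}))"

text \<open>
  The probability \<open>P\<^sub>A(A * A')\<close> that the expansion of \<open>A\<close> is \<open>A * A'\<close> is by convention \<open>P\<^sub>A(A')\<close>,
  that is, \<open>pmf (P A) A'\<close>.
\<close>

definition exchangeable ::
    "('s \<Rightarrow> nat) \<Rightarrow> 's set \<Rightarrow> 's rel_struct set \<Rightarrow>
     ('s rel_struct \<Rightarrow> 's rel_struct pmf) \<Rightarrow> bool" where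
  "exchangeable ar L' \<C> P \<longleftrightarrow>
     (\<forall>r. \<forall>H1\<in>members_on \<C> r. \<forall>H2\<in>members_on \<C> r. \<forall>H'.
        is_structure ar L' H' \<and> universe H' = {1..r} \<longrightarrow> pmf (P H1) H' = pmf (P H2) H')"

end

theory Submission
  imports Defs "HOL-Real_Asymp.Real_Asymp"
begin

text \<open>
  If \<open>P\<close> gave some expansion \<open>H'\<close> different probabilities over \<open>H1\<close> and \<open>H2\<close>, then for every subset
  \<open>X\<close> of the hyperedges one could put \<open>H1\<close> on the hyperedges in \<open>X\<close> and \<open>H2\<close> on the others, and the random
  expansion would contain a member of \<open>\<C>'[n]\<close> whose set of hyperedges carrying \<open>H'\<close> is correlated
  with \<open>X\<close>.  A fixed member of \<open>\<C>'[n]\<close> is correlated with only an exponentially small fraction, in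
  the number \<open>c n^(k + \<alpha>)\<close> of hyperedges, of the subsets \<open>X\<close> (exponential moments), so \<open>\<C>'[n]\<close> would
  have at least \<open>exp (d n^(k + \<alpha>))\<close> elements for some \<open>d > 0\<close>, against the growth rate.
\<close>

section \<open>Analytic estimates and the exponential moment bound\<close>

text \<open>Any positive surplus \<open>a\<close> in the exponent absorbs both constants: with
  \<open>K \<le> exp M\<close>, it suffices that \<open>d * n powr a - 1\<close> exceeds
  \<open>M\<close>, because \<open>n powr b\<close> is at least 1.\<close>

lemma eventually_exp_powr_less:
  fixes a b d K :: real
  assumes "0 \<le> b" "0 < a" "0 < d"
  shows "\<forall>\<^sub>F n in sequentially. K * exp (real n powr b) < exp (d * real n powr (b + a))"
proof -
  \<comment> \<open>The maximum with 1 keeps the logarithm meaningful when \<open>K\<close> is not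
    positive.\<close>
  define M where "M = ln (max 1 K)"
  have KM: "K \<le> exp M"
    by (simp add: M_def)
  have "\<forall>\<^sub>F n in sequentially. max 0 M + 1 < d * real n powr a"
    using assms(2,3) by real_asymp
  then show ?thesis
    using eventually_gt_at_top[of 0]
  proof eventually_elim
    case (elim n)
    have "1 \<le> real n powr b"
      using elim(2) \<open>0 \<le> b\<close> by (intro ge_one_powr_ge_zero) auto
    then have "1 * (d * real n powr a - 1) \<le> real n powr b * (d * real n powr a - 1)"
      using elim(1) by (intro mult_right_mono) auto
    then have "M + real n powr b < d * real n powr (b + a)"
      using elim(1) by (simp add: powr_add algebra_simps)
    moreover have "K * exp (real n powr b) \<le> exp (M + real n powr b)"
      using KM by (simp add: exp_add)
    ultimately show ?case
      by (meson exp_less_mono le_less_trans)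
  qed
qed

text \<open>Both sides are compared with \<open>2 + 2 * x\<^sup>2\<close>. The constant in the
  exponent is not the sharp 1/2, but any constant serves the counting and this one has an elementary
  proof.\<close>

lemma exp_plus_exp_minus_le:
  fixes x :: real
  assumes "\<bar>x\<bar> \<le> 1"
  shows "exp x + exp (- x) \<le> 2 * exp (x\<^sup>2)"
proof -
  have *: "exp y + exp (- y) \<le> 2 + 2 * y\<^sup>2" if y: "0 \<le> y" "y \<le> 1" for y :: real
  proof -
    have up: "exp y \<le> 1 + y + y\<^sup>2"
      using exp_bound y by blast
    \<comment> \<open>Multiplying by \<open>1 - y + y\<^sup>2\<close> turns this lower bound for
      \<open>exp y\<close> into an upper bound for \<open>exp (- y)\<close>, since the product of
      the two polynomials is at least 1.\<close>
    have "1 + y + y\<^sup>2 / 2 \<le> exp y"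
      using exp_lower_Taylor_quadratic y(1) by blast
    moreover have "0 \<le> 1 - y + y\<^sup>2"
      using y zero_le_power2[of y] by linarith
    ultimately have "(1 - y + y\<^sup>2) * (1 + y + y\<^sup>2 / 2) \<le> (1 - y + y\<^sup>2) * exp y"
      by (intro mult_left_mono) auto
    moreover have "(1 - y + y\<^sup>2) * (1 + y + y\<^sup>2 / 2) = 1 + y\<^sup>2 * (1/2 + y/2 + y\<^sup>2/2)"
      by (simp add: power2_eq_square field_simps)
    moreover have "0 \<le> y\<^sup>2 * (1/2 + y/2 + y\<^sup>2/2)"
      using y by simp
    ultimately have "1 \<le> (1 - y + y\<^sup>2) * exp y"
      by linarith
    then have "exp (- y) \<le> 1 - y + y\<^sup>2"
      by (simp add: exp_minus divide_simps)
    then show ?thesis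
      using up by linarith
  qed
  have "exp x + exp (- x) \<le> 2 + 2 * x\<^sup>2"
    using *[of x] *[of "- x"] assms by (cases "0 \<le> x") auto
  also have "\<dots> \<le> 2 * exp (x\<^sup>2)"
    using exp_ge_add_one_self[of "x\<^sup>2"] by linarith
  finally show ?thesis .
qed

text \<open>A Chernoff and union bound. Write \<open>m\<close> for \<open>card E\<close>. For fixed
  \<open>t\<close> and uniformly random \<open>X\<close> the signed sum has independent terms, so
  its exponential moment at \<open>l\<close> is at most \<open>exp (m * l^2)\<close>. As every
  \<open>X\<close> is served by some \<open>t\<close>, \<open>exp (l * m * \<eta>)\<close> is at
  most \<open>card T * exp (m * l^2)\<close>. The choice \<open>l = \<eta> / 2\<close> maximises
  \<open>l * \<eta> - l^2\<close>.\<close>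

lemma exp_le_card_of_signed_sums:
  fixes a :: "'t \<Rightarrow> 'e \<Rightarrow> real" and \<eta> :: real
  assumes "finite E" "finite T"
    and a: "\<And>t e. \<bar>a t e\<bar> \<le> 1"
    and \<eta>: "0 \<le> \<eta>" "\<eta> \<le> 1"
    and ex: "\<And>X. X \<subseteq> E \<Longrightarrow>
      \<exists>t\<in>T. real (card E) * \<eta> \<le> (\<Sum>e\<in>E. if e \<in> X then a t e else - a t e)"
  shows "exp (real (card E) * (\<eta>\<^sup>2 / 4)) \<le> real (card T)"
proof -
  define m where "m = card E"
  define S where "S t X = (\<Sum>e\<in>E. if e \<in> X then a t e else - a t e)" for t X
  have lower: "exp (\<eta> / 2 * (real m * \<eta>)) \<le> (\<Sum>t\<in>T. exp (\<eta> / 2 * S t X))" if "X \<in> Pow E" for X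
  proof -
    obtain t where t: "t \<in> T" "real m * \<eta> \<le> S t X"
      using ex[of X] \<open>X \<in> Pow E\<close> unfolding S_def m_def by auto
    have "exp (\<eta> / 2 * (real m * \<eta>)) \<le> exp (\<eta> / 2 * S t X)"
      using t(2) \<eta> by (simp add: mult_left_mono)
    also have "\<dots> \<le> (\<Sum>t\<in>T. exp (\<eta> / 2 * S t X))"
      by (rule member_le_sum) (use t \<open>finite T\<close> in auto)
    finally show ?thesis .
  qed
  have upper: "(\<Sum>X\<in>Pow E. exp (\<eta> / 2 * S t X)) \<le> (2 * exp ((\<eta> / 2)\<^sup>2)) ^ m" for t
  proof -
    have "exp (\<eta> / 2 * S t X) =
        (\<Prod>e\<in>X. exp (\<eta> / 2 * a t e)) * (\<Prod>e\<in>E-X. exp (- (\<eta> / 2 * a t e)))" if "X \<in> Pow E" for X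
    proof -
      have fin: "finite X" "finite (E - X)"
        using that \<open>finite E\<close> finite_subset by auto
      have "S t X = (\<Sum>e\<in>E - X. if e \<in> X then a t e else - a t e)
          + (\<Sum>e\<in>X. if e \<in> X then a t e else - a t e)"
        unfolding S_def by (rule sum.subset_diff) (use that \<open>finite E\<close> in auto)
      also have "\<dots> = (\<Sum>e\<in>E - X. - a t e) + (\<Sum>e\<in>X. a t e)"
        by simp
      finally have "\<eta> / 2 * S t X = (\<Sum>e\<in>X. \<eta> / 2 * a t e) + (\<Sum>e\<in>E - X. - (\<eta> / 2 * a t e))"
        by (simp only: distrib_left sum_distrib_left add.commute mult_minus_right)
      then show ?thesis
        using fin by (simp only: exp_add exp_sum)
    qed
    \<comment> \<open>Expanding the product over \<open>E\<close> of two-term sums gives one summand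
      per subset \<open>X\<close>; this is the independence of the signs.\<close>
    then have "(\<Sum>X\<in>Pow E. exp (\<eta> / 2 * S t X)) =
        (\<Prod>e\<in>E. exp (\<eta> / 2 * a t e) + exp (- (\<eta> / 2 * a t e)))"
      using prod_add[OF \<open>finite E\<close>, of "\<lambda>e. exp (\<eta> / 2 * a t e)" "\<lambda>e. exp (- (\<eta> / 2 * a t e))"]
      by simp
    also have "\<dots> \<le> (\<Prod>e\<in>E. 2 * exp ((\<eta> / 2)\<^sup>2))"
    proof (rule prod_mono, intro conjI)
      fix e
      have le: "\<bar>\<eta> / 2 * a t e\<bar> \<le> \<bar>\<eta> / 2\<bar>"
        using mult_left_mono[OF a[of t e], of "\<bar>\<eta> / 2\<bar>"] by (simp add: abs_mult)
      have "exp (\<eta> / 2 * a t e) + exp (- (\<eta> / 2 * a t e)) \<le> 2 * exp ((\<eta> / 2 * a t e)\<^sup>2)"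
        by (rule exp_plus_exp_minus_le) (use le \<eta> in linarith)
      also have "\<dots> \<le> 2 * exp ((\<eta> / 2)\<^sup>2)"
        using le by (simp only: abs_le_square_iff exp_le_cancel_iff mult_le_cancel_left_pos zero_less_numeral)
      finally show "exp (\<eta> / 2 * a t e) + exp (- (\<eta> / 2 * a t e)) \<le> 2 * exp ((\<eta> / 2)\<^sup>2)" .
    qed (simp add: add_nonneg_nonneg)
    finally show ?thesis
      by (simp add: m_def)
  qed
  \<comment> \<open>Double counting over the pairs of \<open>X\<close> and \<open>t\<close>:
    \<open>lower\<close> bounds the sum for each \<open>X\<close>, \<open>upper\<close> the sum for
    each \<open>t\<close>.\<close>
  have "2 ^ m * exp (\<eta> / 2 * (real m * \<eta>)) = (\<Sum>X\<in>Pow E. exp (\<eta> / 2 * (real m * \<eta>)))"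
    using \<open>finite E\<close> by (simp add: m_def card_Pow)
  also have "\<dots> \<le> (\<Sum>X\<in>Pow E. \<Sum>t\<in>T. exp (\<eta> / 2 * S t X))"
    by (rule sum_mono) (rule lower)
  also have "\<dots> = (\<Sum>t\<in>T. \<Sum>X\<in>Pow E. exp (\<eta> / 2 * S t X))"
    by (rule sum.swap)
  also have "\<dots> \<le> real (card T) * (2 * exp ((\<eta> / 2)\<^sup>2)) ^ m"
    by (rule sum_bounded_above) (rule upper)
  also have "\<dots> = 2 ^ m * (real (card T) * exp (real m * (\<eta> / 2)\<^sup>2))"
    by (simp add: power_mult_distrib exp_of_nat_mult)
  finally have "exp (\<eta> / 2 * (real m * \<eta>)) \<le> real (card T) * exp (real m * (\<eta> / 2)\<^sup>2)"
    by simp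
  moreover have "\<eta> / 2 * (real m * \<eta>) = real m * (\<eta>\<^sup>2 / 4) + real m * (\<eta> / 2)\<^sup>2"
    by (simp add: power2_eq_square field_simps)
  ultimately have "exp (real m * (\<eta>\<^sup>2 / 4)) * exp (real m * (\<eta> / 2)\<^sup>2)
      \<le> real (card T) * exp (real m * (\<eta> / 2)\<^sup>2)"
    by (simp only: exp_add)
  then show ?thesis
    unfolding m_def by (rule mult_right_le_imp_le) simp
qed

section \<open>Embeddings, isomorphisms and pullbacks\<close>

lemma embedding_comp:
  assumes "embedding f A B" "embedding g B C"
  shows "embedding (g \<circ> f) A C"
proof -
  have f: "f ` universe A \<subseteq> universe B" "inj_on f (universe A)"
    "\<And>s t. set t \<subseteq> universe A \<Longrightarrow> t \<in> interp A s \<longleftrightarrow> map f t \<in> interp B s"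
    and g: "g ` universe B \<subseteq> universe C" "inj_on g (universe B)"
    "\<And>s t. set t \<subseteq> universe B \<Longrightarrow> t \<in> interp B s \<longleftrightarrow> map g t \<in> interp C s"
    using assms unfolding embedding_def by auto
  have "t \<in> interp A s \<longleftrightarrow> map (g \<circ> f) t \<in> interp C s" if "set t \<subseteq> universe A" for s t
  proof -
    have "set (map f t) \<subseteq> universe B"
      using that f(1) by auto
    then show ?thesis
      using f(3)[OF that] g(3)[of "map f t"] by simp
  qed
  moreover have "inj_on (g \<circ> f) (universe A)"
    using f g by (meson comp_inj_on inj_on_subset)
  ultimately show ?thesis
    using f(1) g(1) unfolding embedding_def by (simp add: image_subset_iff)
qed

lemma isomorphic_sym:
  assumes "isomorphic A B"
  shows "isomorphic B A"
proof -
  obtain f where f: "embedding f A B" "f ` universe A = universe B"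
    using assms unfolding isomorphic_def by blast
  then have bij: "bij_betw f (universe A) (universe B)"
    unfolding embedding_def bij_betw_def by blast
  let ?g = "inv_into (universe A) f"
  have g: "bij_betw ?g (universe B) (universe A)"
    using bij by (rule bij_betw_inv_into)
  have "t \<in> interp B s \<longleftrightarrow> map ?g t \<in> interp A s" if t: "set t \<subseteq> universe B" for s t
  proof -
    have "map f (map ?g t) = t"
      using t f(2) by (auto simp: f_inv_into_f subset_iff intro!: map_idI)
    moreover have "set (map ?g t) \<subseteq> universe A"
      using t g unfolding bij_betw_def by auto
    ultimately show ?thesis
      using f(1) unfolding embedding_def by metis
  qed
  then show ?thesis
    using g unfolding isomorphic_def embedding_def bij_betw_def by blast
qed

lemma isomorphic_pullback:
  assumes "bij_betw h X (universe B)"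
  shows "isomorphic B (pullback h X B)"
proof (rule isomorphic_sym)
  show "isomorphic (pullback h X B) B"
    using assms unfolding isomorphic_def embedding_def pullback_def bij_betw_def
    by (intro exI[of _ h]) auto
qed

text \<open>Distinctness of \<open>map h t\<close> forces distinctness of \<open>t\<close>, so
  \<open>h\<close> may be an arbitrary map.\<close>

lemma is_structure_pullback:
  assumes "is_structure ar L B"
  shows "is_structure ar L (pullback h X B)"
  using assms unfolding is_structure_def pullback_def
  by auto (metis length_map, metis distinct_map)

lemma pullback_pullback:
  assumes "f ` X \<subseteq> Y"
  shows "pullback f X (pullback g Y B) = pullback (g \<circ> f) X B"
  using assms unfolding pullback_def by (auto simp: fun_eq_iff)

lemma pullback_cong:
  assumes "\<And>x. x \<in> X \<Longrightarrow> f x = g x"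
  shows "pullback f X B = pullback g X B"
proof -
  have "set t \<subseteq> X \<and> map f t \<in> R \<longleftrightarrow> set t \<subseteq> X \<and> map g t \<in> R" for t R
    using assms by (metis map_cong subsetD)
  then show ?thesis
    unfolding pullback_def by simp
qed

section \<open>Gluing structures along a hypergraph with small overlaps\<close>

text \<open>The free union of the copies: no relation holds of a tuple that is not inside a single
  hyperedge. It serves as the structure \<open>G0\<close> to which overlap closure is
  applied.\<close>

definition glue :: "nat set \<Rightarrow> nat set set \<Rightarrow> (nat set \<Rightarrow> nat \<Rightarrow> nat) \<Rightarrow>
    (nat set \<Rightarrow> 's rel_struct) \<Rightarrow> 's rel_struct" where
  "glue V E b H = RelStruct V (\<lambda>s. \<Union>e\<in>E. map (b e) ` interp (H e) s)"

lemma is_structure_glue: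
  assumes "\<And>e. e \<in> E \<Longrightarrow> is_structure ar L (H e)"
    and "\<And>e. e \<in> E \<Longrightarrow> bij_betw (b e) (universe (H e)) e"
    and "\<And>e. e \<in> E \<Longrightarrow> e \<subseteq> V"
  shows "is_structure ar L (glue V E b H)"
proof -
  have "length u = ar s \<and> set u \<subseteq> V \<and> distinct u"
    if "e \<in> E" "s \<in> L" "t \<in> interp (H e) s" "u = map (b e) t" for e s t u
  proof -
    have t: "length t = ar s" "set t \<subseteq> universe (H e)" "distinct t"
      using assms(1)[OF that(1)] that unfolding is_structure_def by auto
    have b: "inj_on (b e) (universe (H e))" "b e ` universe (H e) = e"
      using assms(2)[OF that(1)] unfolding bij_betw_def by auto
    have "set u \<subseteq> e"
      using t(2) b(2) that(4) by auto
    then show ?thesis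
      using t b assms(3)[OF that(1)] that(4) by (auto simp: distinct_map intro: inj_on_subset)
  qed
  moreover have "interp (H e) s = {}" if "e \<in> E" "s \<notin> L" for e s
    using assms(1)[OF that(1)] that(2) unfolding is_structure_def by auto
  ultimately show ?thesis
    unfolding is_structure_def glue_def by auto
qed

text \<open>A tuple of length greater than \<open>k\<close> lies in at most one hyperedge, so the copies do not interfere.\<close>

lemma embedding_glue:
  assumes str: "\<And>e. e \<in> E \<Longrightarrow> is_structure ar L (H e)"
    and bij: "\<And>e. e \<in> E \<Longrightarrow> bij_betw (b e) (universe (H e)) e"
    and fin: "\<And>e. e \<in> E \<Longrightarrow> finite e"
    and ar: "\<And>s. s \<in> L \<Longrightarrow> k < ar s"
    and overlap: "\<And>e e'. e \<in> E \<Longrightarrow> e' \<in> E \<Longrightarrow> e \<noteq> e' \<Longrightarrow> card (e \<inter> e') \<le> k"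
    and e: "e \<in> E"
  shows "embedding (b e) (H e) (induced (glue V E b H) e)"
proof -
  have b: "inj_on (b e) (universe (H e))" "b e ` universe (H e) = e"
    using bij[OF e] unfolding bij_betw_def by auto
  have "t \<in> interp (H e) s \<longleftrightarrow> map (b e) t \<in> interp (induced (glue V E b H) e) s"
    if t: "set t \<subseteq> universe (H e)" for s t
  proof
    assume "t \<in> interp (H e) s"
    then show "map (b e) t \<in> interp (induced (glue V E b H) e) s"
      using e b(2) t unfolding induced_def glue_def by auto
  next
    \<comment> \<open>The tuple could a priori have been contributed by another hyperedge
      \<open>e'\<close>; its \<open>ar s\<close> distinct entries would then lie in
      \<open>e \<inter> e'\<close>, which has at most \<open>k\<close> elements.\<close>
    assume "map (b e) t \<in> interp (induced (glue V E b H) e) s"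
    then obtain e' t' where e': "e' \<in> E" and t': "t' \<in> interp (H e') s"
      and eq: "map (b e) t = map (b e') t'"
      unfolding induced_def glue_def by auto
    have s: "s \<in> L"
      using str[OF e'] t' unfolding is_structure_def by auto
    then have l: "length t' = ar s" "set t' \<subseteq> universe (H e')" "distinct t'"
      using str[OF e'] t' unfolding is_structure_def by auto
    have b': "inj_on (b e') (universe (H e'))" "b e' ` universe (H e') = e'"
      using bij[OF e'] unfolding bij_betw_def by auto
    have "set (map (b e') t') \<subseteq> e'"
      using l(2) b'(2) by auto
    moreover have "set (map (b e) t) \<subseteq> e"
      using t b(2) by auto
    ultimately have "set (map (b e') t') \<subseteq> e \<inter> e'"
      using eq by auto
    moreover have "distinct (map (b e') t')"
      using l b'(1) by (auto simp: distinct_map intro: inj_on_subset)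
    ultimately have "ar s \<le> card (e \<inter> e')"
      using fin[OF e] l(1) by (metis card_mono distinct_card finite_Int length_map)
    then have "e = e'"
      using overlap[OF e e'] ar[OF s] by linarith
    then have "t = t'"
      using eq b(1) t l(2) by (metis map_inj_on inj_on_subset Un_least)
    then show "t \<in> interp (H e) s"
      using t' \<open>e = e'\<close> by simp
  qed
  then show ?thesis
    using b unfolding embedding_def induced_def by auto
qed

section \<open>Unequal probabilities force many structures\<close>

text \<open>The signed-sum bound is applied to the structures in \<open>members_on \<C>' n\<close>,
  each tested on every hyperedge for carrying \<open>H'\<close>. For each \<open>X\<close>, a
  suitable structure is found among the random expansions of a \<open>G\<close> in
  \<open>\<C>\<close> that realises the pattern \<open>X\<close>.\<close>

lemma exp_le_labelled_growth_rate:
  fixes P :: "'s rel_struct \<Rightarrow> 's rel_struct pmf"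
  assumes C: "hereditary_class ar L \<C>" and C': "hereditary_class ar L' \<C>'"
    and ar: "\<And>s. s \<in> L \<Longrightarrow> k < ar s"
    and P: "consistent_random_expansion ar L' \<C> \<C>' P"
    and H1: "H1 \<in> members_on \<C> r" and H2: "H2 \<in> members_on \<C> r"
    and H': "is_structure ar L' H'" "universe H' = {1..r}"
    and hyp: "uniform_hypergraph r V E" and n: "card V = n"
    and overlap: "\<And>e e'. e \<in> E \<Longrightarrow> e' \<in> E \<Longrightarrow> e \<noteq> e' \<Longrightarrow> card (e \<inter> e') \<le> k"
    and amalgam: "\<And>G0. is_structure ar L G0 \<Longrightarrow> universe G0 = V \<Longrightarrow>
       (\<forall>e\<in>E. isomorphic (induced G0 e) H1 \<or> isomorphic (induced G0 e) H2) \<Longrightarrow>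
       \<exists>G\<in>\<C>. \<exists>g. card (universe G) = n \<and> homomorphism g G0 G \<and> inj_on g V \<and>
         (\<forall>e\<in>E. embedding g (induced G0 e) G)"
    and fin': "finite (members_on \<C>' n)"
    and le: "pmf (P H2) H' \<le> pmf (P H1) H'"
  shows "exp (real (card E) * (((pmf (P H1) H' - pmf (P H2) H') / 2)\<^sup>2 / 4))
           \<le> real (labelled_growth_rate \<C>' n)"
proof -
  have V: "finite V" and E: "\<And>e. e \<in> E \<Longrightarrow> e \<subseteq> V" "\<And>e. e \<in> E \<Longrightarrow> card e = r"
    using hyp unfolding uniform_hypergraph_def by auto
  have finE: "finite E"
    by (rule finite_subset[of _ "Pow V"]) (use V E(1) in auto)
  have fine: "finite e" if "e \<in> E" for e
    using E(1)[OF that] V by (rule finite_subset)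
  have mem: "H1 \<in> \<C>" "H2 \<in> \<C>" and univ: "universe H1 = {1..r}" "universe H2 = {1..r}"
    using H1 H2 unfolding members_on_def by auto
  have str: "is_structure ar L H1" "is_structure ar L H2"
    using C mem unfolding hereditary_class_def by blast+
  have "\<exists>f. bij_betw f {1..r} e" if "e \<in> E" for e
    using ex_bij_betw_nat_finite_1[OF fine[OF that]] E(2)[OF that] by simp
  then obtain b where b: "\<And>e. e \<in> E \<Longrightarrow> bij_betw (b e) {1..r} e"
    by metis
  obtain h where h: "bij_betw h {1..n} V"
    using ex_bij_betw_nat_finite_1[OF V] n by auto
  \<comment> \<open>The labelling \<open>b e\<close> read inside \<open>{1..n}\<close>. It does not
    depend on \<open>X\<close>, so the tests \<open>a\<close> stay fixed while \<open>X\<close>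
    varies.\<close>
  define c where "c e = inv_into {1..n} h \<circ> b e" for e
  \<comment> \<open>Centering at the midpoint makes the two kinds of hyperedges deviate by the same
    amount with opposite signs.\<close>
  define q where "q = (pmf (P H1) H' + pmf (P H2) H') / 2"
  define a where "a T e = indicator {T. pullback (c e) {1..r} T = H'} T - q" for T e
  have q: "0 \<le> q" "q \<le> 1"
    using pmf_le_1[of "P H1" H'] pmf_le_1[of "P H2" H'] by (auto simp: q_def)
  have "exp (real (card E) * (((pmf (P H1) H' - pmf (P H2) H') / 2)\<^sup>2 / 4))
          \<le> real (card (members_on \<C>' n))"
  proof (rule exp_le_card_of_signed_sums[OF finE fin'])
    show "\<bar>a T e\<bar> \<le> 1" for T e
      using q by (auto simp: a_def indicator_def)
    show "0 \<le> (pmf (P H1) H' - pmf (P H2) H') / 2"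
      using le by simp
    show "(pmf (P H1) H' - pmf (P H2) H') / 2 \<le> 1"
      using order.trans[OF diff_left_mono[OF pmf_nonneg[of "P H2" H']], of "pmf (P H1) H'" 2]
        pmf_le_1[of "P H1" H'] by simp
  next
    fix X assume "X \<subseteq> E"
    define H where "H e = (if e \<in> X then H1 else H2)" for e
    define G0 where "G0 = glue V E b H"
    have H: "is_structure ar L (H e)" "universe (H e) = {1..r}" "H e \<in> \<C>" for e
      using str univ mem by (auto simp: H_def)
    have G0: "is_structure ar L G0" "universe G0 = V"
      using is_structure_glue[of E ar L H b V] H(1,2) b E(1) by (simp_all add: G0_def glue_def)
    have emb: "embedding (b e) (H e) (induced G0 e)" if "e \<in> E" for e
      unfolding G0_def
      by (rule embedding_glue[where ar = ar and L = L and k = k])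
        (use H(1,2) b fine ar overlap that in simp_all)
    have "isomorphic (H e) (induced G0 e)" if "e \<in> E" for e
      using emb[OF that] b[OF that] H(2) unfolding isomorphic_def bij_betw_def
      by (auto simp: induced_def)
    then have "\<forall>e\<in>E. isomorphic (induced G0 e) H1 \<or> isomorphic (induced G0 e) H2"
      using isomorphic_sym unfolding H_def by metis
    then obtain G g where G: "G \<in> \<C>" "card (universe G) = n" "homomorphism g G0 G" "inj_on g V"
      and g: "\<And>e. e \<in> E \<Longrightarrow> embedding g (induced G0 e) G"
      using amalgam[OF G0] by blast
    have "finite (universe G)" "g ` V \<subseteq> universe G"
      using C G(1,3) G0(2) unfolding hereditary_class_def homomorphism_def by blast+
    \<comment> \<open>Equal cardinalities make the injection \<open>g\<close> a bijection, so
      \<open>g \<circ> h\<close> labels \<open>G\<close> by \<open>{1..n}\<close>. Relations that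
      \<open>G\<close> has beyond the hyperedges do no harm, as only the embeddings of hyperedges
      are used.\<close>
    then have "bij_betw g V (universe G)"
      using G(2,4) n unfolding bij_betw_def by (metis card_image card_subset_eq)
    then have gh: "bij_betw (g \<circ> h) {1..n} (universe G)"
      using h by (rule bij_betw_trans[rotated])
    define R where "R G' = pullback (g \<circ> h) {1..n} G'" for G' :: "'s rel_struct"
    have R_mem: "R G' \<in> members_on \<C>' n" if "G' \<in> set_pmf (P G)" for G'
    proof -
      have G': "G' \<in> \<C>'" "universe G' = universe G"
        using P G(1) that unfolding consistent_random_expansion_def by auto
      have "isomorphic G' (R G')"
        unfolding R_def by (rule isomorphic_pullback) (use gh G' in simp)
      moreover have "is_structure ar L' (R G')"
        unfolding R_def by (rule is_structure_pullback) (use C' G' in \<open>unfold hereditary_class_def, blast\<close>)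
      ultimately have "R G' \<in> \<C>'"
        using C' G' unfolding hereditary_class_def by blast
      then show ?thesis
        unfolding members_on_def R_def by (simp add: pullback_def)
    qed
    \<comment> \<open>On \<open>{1..r}\<close> the map \<open>h \<circ> c e\<close> is
      \<open>b e\<close>, so the test at \<open>e\<close> on the relabelled expansion sees the copy
      of \<open>H e\<close> in \<open>G\<close>.\<close>
    have R_pull: "pullback (c e) {1..r} (R G') = pullback (g \<circ> b e) {1..r} G'" if "e \<in> E" for e G'
    proof -
      have be: "b e x \<in> V" if "x \<in> {1..r}" for x
        using b[OF \<open>e \<in> E\<close>] E(1)[OF \<open>e \<in> E\<close>] that unfolding bij_betw_def by blast
      have hc: "h (c e x) = b e x" "c e x \<in> {1..n}" if "x \<in> {1..r}" for x
        using be[OF that] h unfolding c_def bij_betw_def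
        by (auto simp: f_inv_into_f simp del: atLeastAtMost_iff intro!: inv_into_into)
      have "pullback (c e) {1..r} (R G') = pullback (g \<circ> h \<circ> c e) {1..r} G'"
        unfolding R_def by (rule pullback_pullback) (use hc in blast)
      also have "\<dots> = pullback (g \<circ> b e) {1..r} G'"
        by (rule pullback_cong) (simp only: hc comp_def)
      finally show ?thesis .
    qed
    \<comment> \<open>Consistency along the embedding \<open>g \<circ> b e\<close> of
      \<open>H e\<close> into \<open>G\<close> makes this expectation depend only on whether
      \<open>e\<close> is in \<open>X\<close>.\<close>
    have prob: "measure_pmf.expectation (P G) (\<lambda>G'. a (R G') e) = pmf (P (H e)) H' - q"
      if "e \<in> E" for e
    proof -
      have "embedding (g \<circ> b e) (H e) G"
        using emb g that embedding_comp by blast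
      then have "pmf (P (H e)) H' =
          measure_pmf.prob (P G) {G'. pullback (g \<circ> b e) (universe (H e)) G' = H'}"
        using P G(1) H(3) H' H(2) unfolding consistent_random_expansion_def by simp
      then have "measure_pmf.prob (P G) {G'. pullback (g \<circ> b e) {1..r} G' = H'} = pmf (P (H e)) H'"
        using H(2) by simp
      moreover have "a (R G') e = indicator {G'. pullback (g \<circ> b e) {1..r} G' = H'} G' - q" for G'
        using R_pull[OF that] by (simp add: a_def indicator_def)
      moreover have "integrable (measure_pmf (P G)) (indicat_real S)" for S
        by (rule measure_pmf.integrable_const_bound[where B = 1]) auto
      ultimately show ?thesis
        by (simp add: Bochner_Integration.integral_diff measure_pmf.prob_space)
    qed
    have int: "integrable (measure_pmf (P G)) (\<lambda>G'. a (R G') e)" for e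
      unfolding a_def indicator_def
      by (rule measure_pmf.integrable_const_bound[where B = "1 + \<bar>q\<bar>"]) auto
    let ?S = "\<lambda>T. \<Sum>e\<in>E. if e \<in> X then a T e else - a T e"
    have int_if: "integrable (measure_pmf (P G)) (\<lambda>G'. if e \<in> X then a (R G') e else - a (R G') e)" for e
      using int by (cases "e \<in> X") simp_all
    have intS: "integrable (measure_pmf (P G)) (\<lambda>G'. ?S (R G'))"
      using int_if by (rule Bochner_Integration.integrable_sum)
    \<comment> \<open>Linearity of expectation is enough: the events at different hyperedges may be
      dependent.\<close>
    have "measure_pmf.expectation (P G) (\<lambda>G'. ?S (R G')) =
        (\<Sum>e\<in>E. measure_pmf.expectation (P G) (\<lambda>G'. if e \<in> X then a (R G') e else - a (R G') e))"
      using int_if by (rule Bochner_Integration.integral_sum)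
    also have "\<dots> = (\<Sum>e\<in>E. (pmf (P H1) H' - pmf (P H2) H') / 2)"
    proof (rule sum.cong[OF refl])
      fix e assume "e \<in> E"
      then show "measure_pmf.expectation (P G) (\<lambda>G'. if e \<in> X then a (R G') e else - a (R G') e) =
          (pmf (P H1) H' - pmf (P H2) H') / 2"
        using prob[of e] by (cases "e \<in> X") (simp_all add: H_def q_def field_simps)
    qed
    finally have mean: "measure_pmf.expectation (P G) (\<lambda>G'. ?S (R G')) =
        real (card E) * ((pmf (P H1) H' - pmf (P H2) H') / 2)"
      by simp
    \<comment> \<open>Some expansion of positive probability reaches the mean, since a variable
      almost surely below its mean is impossible.\<close>
    have "\<exists>G'\<in>set_pmf (P G). real (card E) * ((pmf (P H1) H' - pmf (P H2) H') / 2) \<le> ?S (R G')"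
    proof (rule ccontr)
      assume "\<not> ?thesis"
      then have "AE G' in measure_pmf (P G).
          ?S (R G') < real (card E) * ((pmf (P H1) H' - pmf (P H2) H') / 2)"
        by (auto simp: AE_measure_pmf_iff not_le)
      from measure_pmf.expectation_less[OF intS this] mean show False
        by simp
    qed
    then show "\<exists>T\<in>members_on \<C>' n.
        real (card E) * ((pmf (P H1) H' - pmf (P H2) H') / 2) \<le> ?S T"
      using R_mem by blast
  qed
  then show ?thesis
    by (simp add: labelled_growth_rate_def)
qed

section \<open>Contradiction with the growth rate, and the conclusion\<close>

text \<open>A strict excess over \<open>H1\<close> would give at least
  \<open>exp (d * card E)\<close> structures, where \<open>card E\<close> grows at least like
  \<open>n powr (k + \<alpha>)\<close> along arbitrarily large \<open>n\<close>.\<close>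

lemma pmf_le_of_overlap_closed:
  fixes P :: "'s rel_struct \<Rightarrow> 's rel_struct pmf"
  assumes C: "hereditary_class ar L \<C>" and closed: "overlap_closed k ar L \<C>"
    and C': "hereditary_class ar L' \<C>'"
    and fin: "\<forall>\<^sub>F n in sequentially. finite (members_on \<C>' n)"
    and growth: "\<And>\<delta>::real. \<delta> > 0 \<Longrightarrow>
           (\<lambda>n. real (labelled_growth_rate \<C>' n)) \<in> O(\<lambda>n. exp (real n powr (real k + \<delta>)))"
    and P: "consistent_random_expansion ar L' \<C> \<C>' P"
    and "k < r" and H1: "H1 \<in> members_on \<C> r" and H2: "H2 \<in> members_on \<C> r"
    and H': "is_structure ar L' H'" "universe H' = {1..r}"
  shows "pmf (P H1) H' \<le> pmf (P H2) H'"
proof (rule ccontr)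
  assume "\<not> ?thesis"
  then have less: "pmf (P H2) H' < pmf (P H1) H'"
    by simp
  define d where "d = ((pmf (P H1) H' - pmf (P H2) H') / 2)\<^sup>2 / 4"
  have d: "0 < d"
    using less by (simp add: d_def)
  have ar: "\<And>s. s \<in> L \<Longrightarrow> k < ar s"
    using closed unfolding overlap_closed_def by blast
  obtain c \<alpha> where c: "0 < c" "0 < \<alpha>"
    and ex: "\<forall>N. \<exists>n\<ge>N. \<exists>V E.
        uniform_hypergraph r V E \<and> card V = n \<and>
        c * real n powr (real k + \<alpha>) \<le> real (card E) \<and>
        (\<forall>e\<in>E. \<forall>e'\<in>E. e \<noteq> e' \<longrightarrow> card (e \<inter> e') \<le> k) \<and>
        (\<forall>H1\<in>members_on \<C> r. \<forall>H2\<in>members_on \<C> r. \<forall>G0.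
           is_structure ar L G0 \<and> universe G0 = V \<and>
           (\<forall>e\<in>E. isomorphic (induced G0 e) H1 \<or> isomorphic (induced G0 e) H2) \<longrightarrow>
           (\<exists>G\<in>\<C>. \<exists>g. card (universe G) = n \<and>
              homomorphism g G0 G \<and> inj_on g V \<and>
              (\<forall>e\<in>E. embedding g (induced G0 e) G)))"
    using closed[unfolded overlap_closed_def, THEN conjunct2, THEN spec, THEN mp, OF \<open>k < r\<close>]
    by (elim exE conjE) (rule that; assumption)
  \<comment> \<open>The growth hypothesis is taken at half the surplus \<open>\<alpha>\<close>; the
    other half absorbs \<open>K\<close>, \<open>c\<close> and \<open>d\<close>.\<close>
  obtain K where K: "\<forall>\<^sub>F n in sequentially.
      real (labelled_growth_rate \<C>' n) \<le> K * exp (real n powr (real k + \<alpha> / 2))"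
    using growth[of "\<alpha> / 2"] c(2) by (auto elim!: landau_o.bigE)
  have "\<forall>\<^sub>F n in sequentially. K * exp (real n powr (real k + \<alpha> / 2))
      < exp ((d * c) * real n powr (real k + \<alpha> / 2 + \<alpha> / 2))"
    by (rule eventually_exp_powr_less) (use c d in auto)
  \<comment> \<open>Finiteness is carried along because \<open>card\<close> of an infinite set is 0,
    so that the growth bound alone would not exclude infinitely many members.\<close>
  with K fin have "\<forall>\<^sub>F n in sequentially. finite (members_on \<C>' n) \<and>
      real (labelled_growth_rate \<C>' n) < exp ((d * c) * real n powr (real k + \<alpha>))"
    by eventually_elim (simp add: add.assoc)
  then obtain N where N: "\<And>n. N \<le> n \<Longrightarrow> finite (members_on \<C>' n) \<and>
      real (labelled_growth_rate \<C>' n) < exp ((d * c) * real n powr (real k + \<alpha>))"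
    unfolding eventually_sequentially by blast
  \<comment> \<open>The threshold \<open>N\<close> comes first: hypergraphs exist only for
    arbitrarily large \<open>n\<close>, whereas the upper bound holds for all \<open>n\<close> from
    \<open>N\<close> on.\<close>
  obtain n V E where n: "N \<le> n" and hyp: "uniform_hypergraph r V E" "card V = n"
    and many: "c * real n powr (real k + \<alpha>) \<le> real (card E)"
    and sparse: "\<forall>e\<in>E. \<forall>e'\<in>E. e \<noteq> e' \<longrightarrow> card (e \<inter> e') \<le> k"
    and closed': "\<forall>H1\<in>members_on \<C> r. \<forall>H2\<in>members_on \<C> r. \<forall>G0.
       is_structure ar L G0 \<and> universe G0 = V \<and>
       (\<forall>e\<in>E. isomorphic (induced G0 e) H1 \<or> isomorphic (induced G0 e) H2) \<longrightarrow>
       (\<exists>G\<in>\<C>. \<exists>g. card (universe G) = n \<and> homomorphism g G0 G \<and> inj_on g V \<and>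
          (\<forall>e\<in>E. embedding g (induced G0 e) G))"
    using ex[THEN spec, of N] by (elim exE conjE) (rule that; assumption)
  have overlap: "card (e \<inter> e') \<le> k" if "e \<in> E" "e' \<in> E" "e \<noteq> e'" for e e'
    using sparse that by blast
  note amalgam = closed'[THEN bspec, OF H1, THEN bspec, OF H2, THEN spec, THEN mp, OF conjI, OF _ conjI]
  have "exp (real (card E) * d) \<le> real (labelled_growth_rate \<C>' n)"
    unfolding d_def
    by (rule exp_le_labelled_growth_rate[OF C C' ar P H1 H2 H' hyp overlap amalgam])
      (use N[OF n] less in auto)
  also have "\<dots> < exp ((d * c) * real n powr (real k + \<alpha>))"
    using N[OF n] by blast
  finally have "real (card E) * d < (c * real n powr (real k + \<alpha>)) * d"
    by (simp add: ac_simps)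
  then show False
    using many d by simp
qed

text \<open>With only \<open>r\<close> points there is no tuple of more than \<open>r\<close>
  distinct entries, so every relation is empty.\<close>

lemma members_on_unique_of_small:
  assumes C: "hereditary_class ar L \<C>" and ar: "\<And>s. s \<in> L \<Longrightarrow> r < ar s"
    and "H1 \<in> members_on \<C> r" "H2 \<in> members_on \<C> r"
  shows "H1 = H2"
proof -
  have "interp H s = {}" "universe H = {1..r}" if "H \<in> members_on \<C> r" for H s
  proof -
    have H: "is_structure ar L H" "universe H = {1..r}"
      using C that unfolding hereditary_class_def members_on_def by auto
    have False if t: "t \<in> interp H s" for t
    proof -
      have "s \<in> L"
        using H(1) t unfolding is_structure_def by auto
      then have "length t = ar s" "set t \<subseteq> {1..r}" "distinct t"
        using H t unfolding is_structure_def by auto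
      then have "ar s \<le> r"
        by (metis card_atLeastAtMost card_mono diff_Suc_1 distinct_card finite_atLeastAtMost)
      then show False
        using ar[OF \<open>s \<in> L\<close>] by simp
    qed
    then show "interp H s = {}" "universe H = {1..r}"
      using H by auto
  qed
  then show ?thesis
    using assms(3,4) by (intro rel_struct.expand) (auto simp: fun_eq_iff)
qed

theorem theorem3p7:
  fixes k :: nat
    and ar :: "'s \<Rightarrow> nat"
    and L L' :: "'s set"
    and \<C> \<C>' :: "'s rel_struct set"
    and P :: "'s rel_struct \<Rightarrow> 's rel_struct pmf"
  assumes "1 \<le> k"
    and "L \<inter> L' = {}"
    and "hereditary_class ar L \<C>"
    and "overlap_closed k ar L \<C>"
    and "hereditary_class ar L' \<C>'"
    and "\<forall>\<^sub>F n in sequentially. finite (members_on \<C>' n)"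
    and "\<And>\<delta>::real. \<delta> > 0 \<Longrightarrow>
           (\<lambda>n. real (labelled_growth_rate \<C>' n)) \<in> O(\<lambda>n. exp (real n powr (real k + \<delta>)))"
    and "consistent_random_expansion ar L' \<C> \<C>' P"
  shows "exchangeable ar L' \<C> P"
  unfolding exchangeable_def
proof (intro allI ballI impI)
  fix r H1 H2 H'
  assume H: "H1 \<in> members_on \<C> r" "H2 \<in> members_on \<C> r"
    and H': "is_structure ar L' H' \<and> universe H' = {1..r}"
  show "pmf (P H1) H' = pmf (P H2) H'"
  \<comment> \<open>Overlap closure speaks only of \<open>r > k\<close>; for smaller
    \<open>r\<close> there is at most one structure on \<open>{1..r}\<close>.\<close>
  proof (cases "k < r")
    case True
    have le: "pmf (P A) H' \<le> pmf (P B) H'"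
      if "A \<in> members_on \<C> r" "B \<in> members_on \<C> r" for A B
      using pmf_le_of_overlap_closed[OF assms(3-6) _ assms(8) True that] assms(7) H' by blast
    \<comment> \<open>The two structures play symmetric roles, so the one-sided bound applies in
      both directions.\<close>
    show ?thesis
      using le[OF H] le[OF H(2,1)] H' by (intro antisym)
  next
    case False
    then have "r < ar s" if "s \<in> L" for s
      using assms(4) that unfolding overlap_closed_def by fastforce
    then have "H1 = H2"
      using members_on_unique_of_small[OF assms(3)] H by blast
    then show ?thesis
      by simp
  qed
qed

end
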